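(* Let $n>k$ be natural numbers. There exists a simple graph $G_{n,k}$ on $n$ vertices such that $h_k(G_{n,k})=f_0(n,k)$. Consequently $f(n,k)\leqslant f_0(n,k)$.
   Context: All graphs are finite, undirected, without loops or multiple edges. For a graph $G$ and a natural number $k$, $h_k(G)$ denotes the number of unordered pairs of distinct vertices of $G$ whose degrees differ by less than $k$. For natural numbers $n>k$, $f(n,k)$ is the minimum of $h_k(G)$ over all graphs $G$ on $n$ vertices, and $$f_0(n,k):=\left(\left\lceil \tfrac{n}{k} \right\rceil - 2\right)\binom{k}{2} + \binom{k+1}{2} + \binom{n-k \left( \left\lceil\frac{n}{k} \right\rceil - 1 \right)-1}{2},$$ where $\binom{m}{2}=m(m-1)/2$ (so $\binom{0}{2}=0$). *)

theory Defs
  imports Complex_Main "Graph_Theory.Pair_Digraph"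
begin

text \<open>
  A finite simple undirected graph is a \<^const>\<open>pair_graph\<close>: a finite vertex set with a symmetric,
  irreflexive set of ordered pairs. An undirected edge between \<open>u\<close> and \<open>v\<close> is the two arcs
  \<open>(u, v)\<close> and \<open>(v, u)\<close>, so the out-degree of a vertex is its degree.
\<close>

definition degree :: "'a pair_pre_digraph \<Rightarrow> 'a \<Rightarrow> nat" where
  "degree G v = out_degree (with_proj G) v"

definition h :: "nat \<Rightarrow> 'a pair_pre_digraph \<Rightarrow> nat" where
  "h k G = card {{u, v} | u v. u \<in> pverts G \<and> v \<in> pverts G \<and> u \<noteq> v \<and>
                   \<bar>int (degree G u) - int (degree G v)\<bar> < int k}"

text \<open>
  Every finite graph is isomorphic to one whose vertices are natural numbers, so it suffices to
  let \<open>G\<close> range over those.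
\<close>

definition f_min :: "nat \<Rightarrow> nat \<Rightarrow> nat" where
  "f_min n k = (LEAST m. \<exists>G :: nat pair_pre_digraph.
                  pair_graph G \<and> card (pverts G) = n \<and> h k G = m)"

text \<open>
  The subtractions on \<^typ>\<open>nat\<close> below do not truncate when \<open>0 < k < n\<close>; see \<open>f0_subtractions_exact\<close>.
\<close>

definition f0 :: "nat \<Rightarrow> nat \<Rightarrow> nat" where
  "f0 n k = (nat \<lceil>real n / real k\<rceil> - 2) * (k choose 2) + ((k + 1) choose 2)
            + ((n - k * (nat \<lceil>real n / real k\<rceil> - 1) - 1) choose 2)"

lemma f0_subtractions_exact:
  fixes n k :: nat
  assumes "0 < k" "k < n"
  shows "2 \<le> nat \<lceil>real n / real k\<rceil>"
    and "k * (nat \<lceil>real n / real k\<rceil> - 1) + 1 \<le> n"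
proof -
  define c where "c = nat \<lceil>real n / real k\<rceil>"
  have "1 < real n / real k" using assms by simp
  then have "1 < \<lceil>real n / real k\<rceil>" by (simp add: less_ceiling_iff)
  then have c: "\<lceil>real n / real k\<rceil> = int c" "2 \<le> c" unfolding c_def by linarith+
  show "2 \<le> nat \<lceil>real n / real k\<rceil>" using c(2) by (simp add: c_def)
  have "real c - 1 < real n / real k" using c(1) by linarith
  then have "real k * real (c - 1) < real n"
    using assms c(2) by (simp add: less_divide_eq of_nat_diff mult.commute)
  then have "k * (c - 1) < n" by (metis of_nat_less_iff of_nat_mult)
  then show "k * (nat \<lceil>real n / real k\<rceil> - 1) + 1 \<le> n" by (simp add: c_def)
qed

end

theory Submission
  imports Defs
begin

text \<open>
  Write \<open>n = k * d + r\<close> with \<open>1 \<le> r \<le> k\<close> and blow up a half graph: split the vertices into classes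
  \<open>0, \<dots>, d\<close> and join distinct vertices of classes \<open>i\<close> and \<open>j\<close> iff \<open>i + j \<ge> d\<close>. Passing from class
  \<open>i\<close> to class \<open>i + 1\<close> raises the degree by the size of class \<open>d - i - 1\<close>, except that it loses
  \<open>1\<close> where the classes change from independent sets to cliques. So it suffices that the classes
  \<open>0, \<dots>, d - 1\<close> have size \<open>k\<close>, with one additional vertex in class \<open>d div 2\<close> to pay for that loss.
  The remaining \<open>r - 1\<close> vertices form class \<open>d\<close>, whose size does not matter. Then precisely the
  pairs inside a class have degrees differing by less than \<open>k\<close>.
\<close>

text \<open>Once closeness of degrees means lying in a common class, the counted pairs are the
  2-subsets of the classes. Distinct classes share no such subset, so binomial coefficients add
  up.\<close>

lemma h_eq_sum_classes:
  fixes G :: "'a pair_pre_digraph" and c :: "'a \<Rightarrow> 'b"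
  assumes fin: "finite (pverts G)" "finite I" and c: "c ` pverts G \<subseteq> I"
    and close_iff: "\<And>u v. u \<in> pverts G \<Longrightarrow> v \<in> pverts G \<Longrightarrow>
       \<bar>int (degree G u) - int (degree G v)\<bar> < int k \<longleftrightarrow> c u = c v"
  shows "h k G = (\<Sum>i\<in>I. card {v \<in> pverts G. c v = i} choose 2)"
proof -
  define C where "C i = {v \<in> pverts G. c v = i}" for i
  define E where "E i = {e. e \<subseteq> C i \<and> card e = 2}" for i
  have finC: "finite (C i)" for i using fin by (simp add: C_def)
  have "{{u, v} | u v. u \<in> pverts G \<and> v \<in> pverts G \<and> u \<noteq> v \<and>
          \<bar>int (degree G u) - int (degree G v)\<bar> < int k} = (\<Union>i\<in>I. E i)" (is "?L = _")
  proof (intro subset_antisym subsetI)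
    fix e assume "e \<in> ?L"
    then obtain u v where "e = {u, v}" "u \<in> pverts G" "v \<in> pverts G" "u \<noteq> v" "c u = c v"
      using close_iff by blast
    then have "e \<in> E (c u)" "c u \<in> I" using c by (auto simp: E_def C_def card_2_iff)
    then show "e \<in> (\<Union>i\<in>I. E i)" by blast
  next
    fix e assume "e \<in> (\<Union>i\<in>I. E i)"
    then obtain i where "e \<subseteq> C i" "card e = 2" by (auto simp: E_def)
    moreover then obtain u v where "e = {u, v}" "u \<noteq> v" unfolding card_2_iff by blast
    ultimately have "e = {u, v}" "u \<noteq> v" "u \<in> pverts G" "v \<in> pverts G" "c u = c v"
      by (simp_all add: C_def)
    then show "e \<in> ?L" using close_iff[of u v] by blast
  qed
  then have "h k G = card (\<Union>i\<in>I. E i)" by (simp add: h_def)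
  also have "\<dots> = (\<Sum>i\<in>I. card (E i))"
  proof (rule card_UN_disjoint)
    show "\<forall>i\<in>I. finite (E i)"
      using finC by (auto simp: E_def intro: finite_subset[of _ "Pow (C _)"])
    show "\<forall>i\<in>I. \<forall>j\<in>I. i \<noteq> j \<longrightarrow> E i \<inter> E j = {}"
      by (auto simp: E_def C_def card_2_iff)
  qed (use fin in simp)
  also have "\<dots> = (\<Sum>i\<in>I. card (C i) choose 2)"
    by (simp add: E_def n_subsets finC)
  finally show ?thesis by (simp add: C_def)
qed

text \<open>The additional vertex \<open>k * d\<close> is numbered after all blocks, so that the
  other vertices of each class below \<open>d\<close> form an interval of length
  \<open>k\<close>.\<close>

definition blowup_class :: "nat \<Rightarrow> nat \<Rightarrow> nat \<Rightarrow> nat" where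
  "blowup_class k d v = (if v < k * d then v div k else if v = k * d then d div 2 else d)"

definition blowup_graph :: "nat \<Rightarrow> nat \<Rightarrow> nat \<Rightarrow> nat pair_pre_digraph" where
  "blowup_graph n k d = \<lparr>pverts = {..<n},
     parcs = {(u, v). u < n \<and> v < n \<and> u \<noteq> v \<and> d \<le> blowup_class k d u + blowup_class k d v}\<rparr>"

lemma pair_graph_blowup_graph: "pair_graph (blowup_graph n k d)"
proof
  have "parcs (blowup_graph n k d) \<subseteq> {..<n} \<times> {..<n}"
    by (auto simp: blowup_graph_def)
  then show "finite (parcs (blowup_graph n k d))"
    by (rule finite_subset) simp
qed (auto simp: blowup_graph_def symmetric_def sym_def arcs_ends_def arc_to_ends_def image_iff add.commute)

lemma blowup_class_le: "blowup_class k d v \<le> d"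
  by (auto simp: blowup_class_def div_less_iff_less_mult mult.commute
      intro: less_imp_le less_mult_imp_div_less)

text \<open>The set contains \<open>v\<close> itself exactly when \<open>d - i \<le> i\<close>; a
  vertex is not its own neighbour, hence the correction.\<close>

lemma degree_blowup_graph:
  fixes n k d v :: nat
  assumes "v < n"
  defines "i \<equiv> blowup_class k d v"
  shows "int (degree (blowup_graph n k d) v) =
    int (card {w. w < n \<and> d - i \<le> blowup_class k d w}) - of_bool (d \<le> 2 * i)"
proof -
  let ?S = "{w. w < n \<and> d - i \<le> blowup_class k d w}"
  have "out_arcs (with_proj (blowup_graph n k d)) v = Pair v ` (?S - {v})"
    using assms by (auto simp: out_arcs_def blowup_graph_def image_iff)
  then have "degree (blowup_graph n k d) v = card (?S - {v})"
    by (simp add: degree_def out_degree_def card_image inj_on_def)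
  moreover have "v \<in> ?S \<longleftrightarrow> d \<le> 2 * i" using assms by auto
  moreover have "finite ?S" by simp
  moreover have "v \<in> ?S \<Longrightarrow> 0 < card ?S" by (auto simp: card_gt_0_iff)
  ultimately show ?thesis by (auto simp: card_Diff_singleton_if of_nat_diff)
qed

lemma degree_blowup_graph_gap:
  assumes k: "0 < k" and n: "k * d < n" and u: "u < n" and v: "v < n"
    and less: "blowup_class k d u < blowup_class k d v"
  shows "int (degree (blowup_graph n k d) u) + int k \<le> int (degree (blowup_graph n k d) v)"
proof -
  let ?c = "blowup_class k d"
  define i j where "i = ?c u" and "j = ?c v"
  define S where "S i = {w. w < n \<and> d - i \<le> ?c w}" for i
  \<comment> \<open>The full blocks that become neighbours when the class rises from
    \<open>i\<close> to \<open>j\<close>: those of classes \<open>d - j\<close> up to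
    \<open>d - i - 1\<close>. There are \<open>j - i \<ge> 1\<close> of them.\<close>
  define M where "M = {k * (d - j)..<k * (d - i)}"
  \<comment> \<open>The additional vertex, taken exactly when \<open>v\<close> suffers the
    correction for itself and \<open>u\<close> does not. In that case its class
    \<open>d div 2\<close> lies between \<open>d - j\<close> and \<open>d - i - 1\<close>, so its
    gain offsets the loss.\<close>
  define Z where "Z = {w. w = k * d \<and> 2 * i < d \<and> d \<le> 2 * j}"
  have ij: "i < j" "j \<le> d" using less blowup_class_le by (auto simp: i_def j_def)
  have fin: "finite (S i)" for i by (simp add: S_def)
  have M_lt: "w < k * d" if "w \<in> M" for w
    using that by (auto simp: M_def elim!: order_less_le_trans)
  have M_class: "d - j \<le> ?c w \<and> ?c w < d - i" if "w \<in> M" for w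
  proof -
    have "?c w = w div k" using M_lt[OF that] by (simp add: blowup_class_def)
    moreover have "k * (d - j) \<le> w" "w < k * (d - i)" using that by (auto simp: M_def)
    ultimately show ?thesis using k
      by (simp add: less_eq_div_iff_mult_less_eq div_less_iff_less_mult mult.commute)
  qed
  have Z_class: "d - j \<le> ?c w \<and> ?c w < d - i" if "w \<in> Z" for w
    using that ij by (auto simp: Z_def blowup_class_def)
  have sub: "S i \<union> (M \<union> Z) \<subseteq> S j"
    using ij n M_lt M_class Z_class by (fastforce simp: S_def Z_def)
  have disj: "S i \<inter> (M \<union> Z) = {}"
    using M_class Z_class by (fastforce simp: S_def)
  have finMZ: "finite M" "finite Z" by (auto simp: M_def Z_def)
  have "M \<inter> Z = {}" using M_lt by (auto simp: Z_def)
  then have "card (S i) + (card M + card Z) = card (S i \<union> (M \<union> Z))"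
    using fin finMZ disj by (simp add: card_Un_disjoint)
  also have "\<dots> \<le> card (S j)" using sub fin by (rule card_mono[rotated])
  finally have "card (S i) + (card M + card Z) \<le> card (S j)" .
  moreover have "k \<le> card M"
  proof -
    have "card M = k * (j - i)"
      using ij by (simp add: M_def flip: diff_mult_distrib2)
    moreover have "1 \<le> j - i" using ij by simp
    ultimately show ?thesis by simp
  qed
  moreover have "card Z = of_bool (2 * i < d \<and> d \<le> 2 * j)" by (auto simp: Z_def)
  ultimately show ?thesis
    using degree_blowup_graph[OF u, of k d] degree_blowup_graph[OF v, of k d] ij
    unfolding i_def[symmetric] j_def[symmetric] S_def[symmetric]
    by (auto split: if_splits)
qed

lemma h_blowup_graph:
  assumes k: "0 < k" and d: "0 < d" and n: "k * d < n"
  shows "h k (blowup_graph n k d) =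
    (d - 1) * (k choose 2) + ((k + 1) choose 2) + ((n - k * d - 1) choose 2)"
proof -
  let ?G = "blowup_graph n k d" and ?c = "blowup_class k d"
  have V: "pverts ?G = {..<n}" by (simp add: blowup_graph_def)
  \<comment> \<open>Different classes are separated by the gap lemma; equal classes give equal
    degrees, because the degree formula depends on the class alone.\<close>
  have close_iff: "\<bar>int (degree ?G u) - int (degree ?G v)\<bar> < int k \<longleftrightarrow> ?c u = ?c v"
    if "u < n" "v < n" for u v
    using that degree_blowup_graph_gap[OF k n, of u v] degree_blowup_graph_gap[OF k n, of v u]
      degree_blowup_graph[of u n k d] degree_blowup_graph[of v n k d] k
    by (cases "?c u" "?c v" rule: linorder_cases) auto
  \<comment> \<open>Since \<open>d > 0\<close>, this class is not the top one: the additional vertex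
    enlarges a block of size \<open>k\<close> to \<open>k + 1\<close>.\<close>
  define m where "m = d div 2"
  have m: "m < d" using d by (simp add: m_def)
  have block: "v < k * d \<and> v div k = i \<longleftrightarrow> v \<in> {k * i..<k * i + k}" if "i < d" for v i
  proof -
    have "k * i + k \<le> k * d" using that by (metis mult_Suc_right add.commute Suc_leI mult_le_mono2)
    moreover have "v div k = i \<longleftrightarrow> k * i \<le> v \<and> v < k * i + k"
      using dividend_less_times_div[OF k, of v] by (auto intro: div_nat_eqI)
    ultimately show ?thesis by auto
  qed
  have low: "?c v = v div k" "v < n" if "v < k * d" for v
    using that n by (simp_all add: blowup_class_def)
  have high: "?c v = (if v = k * d then m else d)" if "\<not> v < k * d" for v
    using that by (simp add: blowup_class_def m_def)
  have class_iff: "v < n \<and> ?c v = i \<longleftrightarrow> v \<in> {k * i..<k * i + k} \<or> v = k * d \<and> i = m"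
    if "i < d" for v i
    using low[of v] high[of v] block[OF that, of v] n that by (cases "v < k * d") auto
  have card_block: "card {v \<in> {..<n}. ?c v = i} = k" if "i < d" "i \<noteq> m" for i
  proof -
    have "{v \<in> {..<n}. ?c v = i} = {k * i..<k * i + k}"
      using class_iff[OF that(1)] that(2) by blast
    then show ?thesis by simp
  qed
  have card_mid: "card {v \<in> {..<n}. ?c v = m} = k + 1"
  proof -
    have "{v \<in> {..<n}. ?c v = m} = insert (k * d) {k * m..<k * m + k}"
      using class_iff[OF m] by blast
    moreover have "k * d \<notin> {k * m..<k * m + k}" using block[OF m] by blast
    ultimately show ?thesis by simp
  qed
  have card_top: "card {v \<in> {..<n}. ?c v = d} = n - k * d - 1"
  proof -
    \<comment> \<open>The interval is open on the left because \<open>k * d\<close> belongs to class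
      \<open>m < d\<close>; it may be empty.\<close>
    have "{v \<in> {..<n}. ?c v = d} = {k * d<..<n}"
    proof (rule set_eqI)
      fix v
      have "v div k < d" if "v < k * d"
        using that by (simp add: less_mult_imp_div_less mult.commute)
      then show "v \<in> {v \<in> {..<n}. ?c v = d} \<longleftrightarrow> v \<in> {k * d<..<n}"
        using low[of v] high[of v] m by (cases "v < k * d") auto
    qed
    then show ?thesis by simp
  qed
  have "h k ?G = (\<Sum>i\<le>d. card {v \<in> {..<n}. ?c v = i} choose 2)"
    using h_eq_sum_classes[of ?G "{..d}" ?c k] close_iff blowup_class_le
    by (simp add: V image_subset_iff)
  also have "\<dots> = (\<Sum>i<d. card {v \<in> {..<n}. ?c v = i} choose 2) + ((n - k * d - 1) choose 2)"
    using card_top by (simp flip: lessThan_Suc_atMost)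
  also have "(\<Sum>i<d. card {v \<in> {..<n}. ?c v = i} choose 2) =
      (card {v \<in> {..<n}. ?c v = m} choose 2) +
      (\<Sum>i\<in>{..<d} - {m}. card {v \<in> {..<n}. ?c v = i} choose 2)"
    using m by (intro sum.remove) auto
  also have "\<dots> = ((k + 1) choose 2) + (\<Sum>i\<in>{..<d} - {m}. k choose 2)"
    using card_mid card_block by (intro arg_cong2[where f = "(+)"] sum.cong) auto
  finally show ?thesis using m by (simp add: algebra_simps)
qed

text \<open>The remainder \<open>r = n - k * d\<close> has to lie in \<open>1, \<dots>, k\<close>,
  so the quotient is taken of \<open>n - 1\<close>: for \<open>k\<close> dividing \<open>n\<close>
  this yields \<open>r = k\<close> instead of \<open>0\<close>.\<close>

lemma nat_ceiling_divide_eq: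
  assumes "0 < k" "0 < n"
  shows "nat \<lceil>real n / real k\<rceil> = Suc ((n - 1) div k)"
proof -
  define d where "d = (n - 1) div k"
  have "k * d \<le> n - 1" "n - 1 < k * d + k"
    using assms dividend_less_times_div[of k "n - 1"] by (auto simp: d_def)
  then have "k * d < n" "n \<le> k * d + k" using assms by linarith+
  then have "real k * real d < real n" "real n \<le> real k * real d + real k"
    by (metis of_nat_mult of_nat_less_iff, metis of_nat_mult of_nat_add of_nat_le_iff)
  then have "\<lceil>real n / real k\<rceil> = int d + 1"
    using assms by (intro ceiling_unique) (auto simp: field_simps)
  then show ?thesis by (simp add: d_def)
qed

theorem theorem1:
  fixes n k :: nat
  assumes "0 < k" and "k < n"
  shows "(\<exists>G :: nat pair_pre_digraph.
            pair_graph G \<and> card (pverts G) = n \<and> h k G = f0 n k)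
         \<and> f_min n k \<le> f0 n k"
proof -
  define d where "d = (n - 1) div k"
  have c: "nat \<lceil>real n / real k\<rceil> = Suc d"
    using assms nat_ceiling_divide_eq by (simp add: d_def)
  have "0 < d" "k * d < n"
    using f0_subtractions_exact[OF assms] unfolding c by auto
  then have "h k (blowup_graph n k d) = f0 n k"
    using h_blowup_graph assms by (simp add: f0_def c)
  moreover have "card (pverts (blowup_graph n k d)) = n"
    by (simp add: blowup_graph_def)
  ultimately have ex: "\<exists>G :: nat pair_pre_digraph.
      pair_graph G \<and> card (pverts G) = n \<and> h k G = f0 n k"
    using pair_graph_blowup_graph by blast
  then show ?thesis unfolding f_min_def by (auto intro: Least_le)
qed

end
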